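(* Let $X$ and $Y$ be real Banach spaces and let $x\in B_X$, $y\in B_Y$. Assume that $(x,y)$ is a Daugavet-point in $X\oplus_\infty Y$. Then $x$ is a Daugavet-point in $X$ or $y$ is a Daugavet-point in $Y$.
   Context: All Banach spaces are real. $B_X$ and $S_X$ denote the closed unit ball and unit sphere of $X$. For $x\in S_X$ and $\varepsilon>0$ put $\Delta_\varepsilon(x)=\{y\in B_X : \|x-y\|\ge 2-\varepsilon\}$. A point $x\in S_X$ is a Daugavet-point of $X$ if $B_X\subset\overline{\mathrm{conv}}\,\Delta_\varepsilon(x)$ for every $\varepsilon>0$ (in particular a Daugavet-point has norm one). $X\oplus_\infty Y$ is the direct sum $X\oplus Y$ with norm $\|(x,y)\|_\infty=\max\{\|x\|,\|y\|\}$. *)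

theory Defs
  imports "HOL-Analysis.Analysis"
begin

text \<open>The library norm on \<^typ>\<open>'a \<times> 'b\<close> is the Euclidean one,
  so \<open>X \<oplus>\<^sub>\<infinity> Y\<close> needs a type of its own.\<close>

datatype ('a, 'b) linf_sum = Linf (linf_fst: 'a) (linf_snd: 'b)

instantiation linf_sum :: (real_normed_vector, real_normed_vector) real_normed_vector
begin

definition zero_linf_sum :: "('a, 'b) linf_sum" where
  "0 = Linf 0 0"

definition plus_linf_sum :: "('a, 'b) linf_sum \<Rightarrow> ('a, 'b) linf_sum \<Rightarrow> ('a, 'b) linf_sum" where
  "u + v = Linf (linf_fst u + linf_fst v) (linf_snd u + linf_snd v)"

definition minus_linf_sum :: "('a, 'b) linf_sum \<Rightarrow> ('a, 'b) linf_sum \<Rightarrow> ('a, 'b) linf_sum" where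
  "u - v = Linf (linf_fst u - linf_fst v) (linf_snd u - linf_snd v)"

definition uminus_linf_sum :: "('a, 'b) linf_sum \<Rightarrow> ('a, 'b) linf_sum" where
  "- u = Linf (- linf_fst u) (- linf_snd u)"

definition scaleR_linf_sum :: "real \<Rightarrow> ('a, 'b) linf_sum \<Rightarrow> ('a, 'b) linf_sum" where
  "r *\<^sub>R u = Linf (r *\<^sub>R linf_fst u) (r *\<^sub>R linf_snd u)"

definition norm_linf_sum :: "('a, 'b) linf_sum \<Rightarrow> real" where
  "norm u = max (norm (linf_fst u)) (norm (linf_snd u))"

definition dist_linf_sum :: "('a, 'b) linf_sum \<Rightarrow> ('a, 'b) linf_sum \<Rightarrow> real" where
  "dist_linf_sum u v = norm (u - v)"

definition sgn_linf_sum :: "('a, 'b) linf_sum \<Rightarrow> ('a, 'b) linf_sum" where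
  "sgn_linf_sum u = inverse (norm u) *\<^sub>R u"

definition uniformity_linf_sum :: "(('a, 'b) linf_sum \<times> ('a, 'b) linf_sum) filter" where
  "uniformity_linf_sum = (INF e\<in>{0<..}. principal {(u, v). dist u v < e})"

definition open_linf_sum :: "('a, 'b) linf_sum set \<Rightarrow> bool" where
  "open_linf_sum U \<longleftrightarrow> (\<forall>u\<in>U. eventually (\<lambda>(u', v). u' = u \<longrightarrow> v \<in> U) uniformity)"

instance
proof
  fix a b :: real and u v w :: "('a, 'b) linf_sum"
  show "norm (u + v) \<le> norm u + norm v"
    using norm_triangle_ineq[of "linf_fst u" "linf_fst v"]
      norm_triangle_ineq[of "linf_snd u" "linf_snd v"]
    by (simp add: norm_linf_sum_def plus_linf_sum_def max_def)
  show "norm (a *\<^sub>R u) = \<bar>a\<bar> * norm u"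
    by (simp add: norm_linf_sum_def scaleR_linf_sum_def max_mult_distrib_left)
  show "norm u = 0 \<longleftrightarrow> u = 0"
    by (cases u) (auto simp: norm_linf_sum_def zero_linf_sum_def max_def)
qed (simp_all add: zero_linf_sum_def plus_linf_sum_def minus_linf_sum_def uminus_linf_sum_def
      scaleR_linf_sum_def dist_linf_sum_def sgn_linf_sum_def open_linf_sum_def
      uniformity_linf_sum_def algebra_simps)

end

instance linf_sum :: (banach, banach) banach
proof
  fix X :: "nat \<Rightarrow> ('a, 'b) linf_sum"
  assume X: "Cauchy X"
  have fst: "Cauchy (\<lambda>n. linf_fst (X n))" and snd: "Cauchy (\<lambda>n. linf_snd (X n))"
    using X by (fastforce simp: Cauchy_def dist_norm norm_linf_sum_def minus_linf_sum_def)+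
  obtain a where a: "(\<lambda>n. linf_fst (X n)) \<longlonglongrightarrow> a"
    using fst Cauchy_convergent convergent_def by blast
  obtain b where b: "(\<lambda>n. linf_snd (X n)) \<longlonglongrightarrow> b"
    using snd Cauchy_convergent convergent_def by blast
  have "X \<longlonglongrightarrow> Linf a b"
  proof (rule tendstoI)
    fix e :: real
    assume "0 < e"
    then have "\<forall>\<^sub>F n in sequentially. dist (linf_fst (X n)) a < e"
      and "\<forall>\<^sub>F n in sequentially. dist (linf_snd (X n)) b < e"
      using a b by (auto dest: tendstoD)
    then show "\<forall>\<^sub>F n in sequentially. dist (X n) (Linf a b) < e"
      by eventually_elim (simp add: dist_norm norm_linf_sum_def minus_linf_sum_def)
  qed
  then show "convergent X"
    by (auto simp: convergent_def)
qed

definition far_points :: "real \<Rightarrow> 'a::real_normed_vector \<Rightarrow> 'a set" where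
  "far_points \<epsilon> x = {y \<in> cball 0 1. norm (x - y) \<ge> 2 - \<epsilon>}"

definition Daugavet_point :: "'a::real_normed_vector \<Rightarrow> bool" where
  "Daugavet_point x \<longleftrightarrow>
     x \<in> sphere 0 1 \<and> (\<forall>\<epsilon>>0. cball 0 1 \<subseteq> closure (convex hull far_points \<epsilon> x))"

end

theory Submission
  imports Defs
begin

text \<open>If \<open>x\<close> is not a Daugavet-point, some point of the ball has positive distance to the convex hull
  of the far points of \<open>x\<close>. Rescaling this distance so that its supremum over the ball is \<open>1\<close> gives a
  convex function \<open>f\<close> that vanishes at the far points (take \<open>f = 1\<close> if there
  are none, as happens when \<open>norm x < 1\<close> and \<open>\<epsilon>\<close> is small). If \<open>g\<close> is such a function for \<open>y\<close>, then
  \<open>f u + g v \<le> 1\<close> whenever \<open>(u, v)\<close> is far from \<open>(x, y)\<close>, and this bound extends to the closed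
  convex hull, hence to the ball if \<open>(x, y)\<close> is a Daugavet-point. But the supremum of \<open>f u + g v\<close>
  over the ball is \<open>2\<close>.\<close>

text \<open>The infimum in \<open>infdist\<close> need not be attained, so take points of
  \<open>C\<close> that are optimal for \<open>u\<close> and \<open>v\<close> up to
  \<open>e\<close>. Convexity keeps their combination in \<open>C\<close>, and the two errors
  average to \<open>e\<close> again.\<close>

lemma convex_on_infdist:
  fixes C :: "'a::real_normed_vector set"
  assumes "convex C"
  shows "convex_on UNIV (\<lambda>u. infdist u C)"
proof (cases "C = {}")
  \<comment> \<open>By convention \<open>infdist\<close> to the empty set is the constant 0.\<close>
  case True
  then show ?thesis
    by (simp add: infdist_def convex_on_const)
next
  case False
  show ?thesis
  proof (rule convex_onI)
    fix t :: real and u v :: 'a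
    assume t: "0 < t" "t < 1"
    show "infdist ((1 - t) *\<^sub>R u + t *\<^sub>R v) C \<le> (1 - t) * infdist u C + t * infdist v C"
    proof (rule field_le_epsilon)
      fix e :: real
      assume "0 < e"
      obtain a where a: "a \<in> C" "dist u a < infdist u C + e"
        using cInf_lessD[of "dist u ` C" "infdist u C + e"] False \<open>0 < e\<close>
        by (auto simp: infdist_notempty)
      obtain b where b: "b \<in> C" "dist v b < infdist v C + e"
        using cInf_lessD[of "dist v ` C" "infdist v C + e"] False \<open>0 < e\<close>
        by (auto simp: infdist_notempty)
      have "(1 - t) *\<^sub>R a + t *\<^sub>R b \<in> C"
        using assms a(1) b(1) t by (simp add: convex_alt)
      then have "infdist ((1 - t) *\<^sub>R u + t *\<^sub>R v) C
          \<le> dist ((1 - t) *\<^sub>R u + t *\<^sub>R v) ((1 - t) *\<^sub>R a + t *\<^sub>R b)"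
        by (rule infdist_le)
      also have "\<dots> = norm ((1 - t) *\<^sub>R (u - a) + t *\<^sub>R (v - b))"
        by (simp add: dist_norm algebra_simps)
      also have "\<dots> \<le> (1 - t) * dist u a + t * dist v b"
        using norm_triangle_ineq[of "(1 - t) *\<^sub>R (u - a)" "t *\<^sub>R (v - b)"] t
        by (simp add: dist_norm)
      also have "\<dots> \<le> (1 - t) * (infdist u C + e) + t * (infdist v C + e)"
        using a(2) b(2) t by (intro add_mono mult_left_mono) auto
      also have "\<dots> = (1 - t) * infdist u C + t * infdist v C + e"
        by (simp add: algebra_simps)
      finally show "infdist ((1 - t) *\<^sub>R u + t *\<^sub>R v) C
          \<le> (1 - t) * infdist u C + t * infdist v C + e" .
    qed
  qed simp
qed

lemma far_points_empty:
  fixes x :: "'a::real_normed_vector"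
  assumes "norm x < 1 - \<epsilon>"
  shows "far_points \<epsilon> x = {}"
proof -
  have "norm (x - y) < 2 - \<epsilon>" if "norm y \<le> 1" for y
    using norm_triangle_ineq4[of x y] assms that by linarith
  then show ?thesis
    by (force simp: far_points_def)
qed

text \<open>The supremum of the rescaled distance may not be attained, so \<open>u\<close> comes
  only with \<open>f u > 1 / 2\<close>. This suffices: two such values add up to more than
  1.\<close>

lemma not_Daugavet_pointE:
  fixes x :: "'a::real_normed_vector"
  assumes "norm x \<le> 1" and "\<not> Daugavet_point x"
  obtains \<epsilon> and f :: "'a \<Rightarrow> real" and u
  where "\<epsilon> > 0" "convex_on UNIV f" "continuous_on UNIV f"
    "\<forall>w\<in>cball 0 1. f w \<le> 1" "\<forall>w\<in>far_points \<epsilon> x. f w = 0"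
    "u \<in> cball 0 1" "f u > 1 / 2"
proof (cases "\<exists>\<epsilon>>0. far_points \<epsilon> x = {}")
  case True
  then obtain \<epsilon> where "\<epsilon> > 0" "far_points \<epsilon> x = {}"
    by blast
  then show thesis
    by (intro that[of \<epsilon> "\<lambda>_. 1" 0]) (auto simp: convex_on_const)
next
  case False
  \<comment> \<open>If \<open>norm x < 1\<close>, the choice (1 - \<open>norm x\<close>) / 2 for
    \<epsilon> would leave no far points. Hence it is the inclusion of the ball that fails for some
    \<epsilon>.\<close>
  have "norm x = 1"
  proof (rule ccontr)
    assume "norm x \<noteq> 1"
    then have "far_points ((1 - norm x) / 2) x = {}"
      using assms(1) by (intro far_points_empty) (simp add: field_simps)
    then show False
      using False \<open>norm x \<noteq> 1\<close> assms(1) by (auto dest: spec[of _ "(1 - norm x) / 2"])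
  qed
  then obtain \<epsilon> where \<epsilon>: "\<epsilon> > 0"
    and "\<not> cball 0 1 \<subseteq> closure (convex hull far_points \<epsilon> x)"
    using assms(2) by (auto simp: Daugavet_point_def)
  then obtain u\<^sub>0 where u\<^sub>0: "u\<^sub>0 \<in> cball 0 1"
    and notin: "u\<^sub>0 \<notin> closure (convex hull far_points \<epsilon> x)"
    by blast
  define C where "C = convex hull far_points \<epsilon> x"
  \<comment> \<open>One far point makes \<open>C\<close> nonempty, so that \<open>infdist\<close>
    vanishes only on the closure of \<open>C\<close>; it also bounds \<open>infdist\<close> on the
    ball by 2, so that the supremum \<open>s\<close> is finite.\<close>
  obtain c where c: "c \<in> far_points \<epsilon> x"
    using False \<epsilon> by blast
  then have "c \<in> C" and "norm c \<le> 1"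
    by (auto simp: C_def hull_inc far_points_def)
  define s where "s = (SUP w\<in>cball 0 1. infdist w C)"
  have bdd: "bdd_above ((\<lambda>w. infdist w C) ` cball 0 1)"
  proof (rule bdd_aboveI2)
    fix w :: 'a
    assume "w \<in> cball 0 1"
    then have "dist w c \<le> 2"
      using \<open>norm c \<le> 1\<close> norm_triangle_ineq4[of w c] by (simp add: dist_norm)
    then show "infdist w C \<le> 2"
      using infdist_le[OF \<open>c \<in> C\<close>, of w] by linarith
  qed
  have le_s: "infdist w C \<le> s" if "w \<in> cball 0 1" for w
    unfolding s_def using that bdd by (rule cSUP_upper)
  have "infdist u\<^sub>0 C > 0"
    using notin[folded C_def] \<open>c \<in> C\<close> in_closure_iff_infdist_zero[of C u\<^sub>0] infdist_nonneg[of u\<^sub>0 C]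
    by (metis emptyE order_le_less)
  then have "s > 0"
    using le_s[OF u\<^sub>0] by linarith
  then obtain u where u: "u \<in> cball 0 1" "infdist u C > s / 2"
    using less_cSUP_iff[OF _ bdd, of "s / 2"] unfolding s_def[symmetric] by auto
  show thesis
  proof (rule that[of \<epsilon> "\<lambda>w. inverse s * infdist w C" u])
    show "convex_on UNIV (\<lambda>w. inverse s * infdist w C)"
      using \<open>s > 0\<close> by (intro convex_on_cmul convex_on_infdist) (auto simp: C_def)
    show "\<forall>w\<in>far_points \<epsilon> x. inverse s * infdist w C = 0"
      by (simp add: C_def hull_inc)
    show "continuous_on UNIV (\<lambda>w. inverse s * infdist w C)"
      by (intro continuous_intros)
    show "\<forall>w\<in>cball 0 1. inverse s * infdist w C \<le> 1"
    proof
      fix w :: 'a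
      assume "w \<in> cball 0 1"
      then show "inverse s * infdist w C \<le> 1"
        using le_s[of w] \<open>s > 0\<close> by (simp add: field_simps)
    qed
    show "1 / 2 < inverse s * infdist u C"
      using u(2) \<open>s > 0\<close> by (simp add: field_simps)
  qed (fact \<epsilon> u(1))+
qed

lemma bounded_linear_linf_fst: "bounded_linear linf_fst"
  by (rule bounded_linear_intro[where K = 1])
    (simp_all add: plus_linf_sum_def scaleR_linf_sum_def norm_linf_sum_def)

lemma bounded_linear_linf_snd: "bounded_linear linf_snd"
  by (rule bounded_linear_intro[where K = 1])
    (simp_all add: plus_linf_sum_def scaleR_linf_sum_def norm_linf_sum_def)

lemma convex_on_compose_linear:
  assumes "linear h" and "convex_on UNIV f"
  shows "convex_on UNIV (\<lambda>w. f (h w))"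
  using assms by (auto simp: convex_on_def linear_add linear_scale)

text \<open>The larger coordinate of the difference realises the max norm, and
  \<open>min \<epsilon> \<delta>\<close> is at most either tolerance.\<close>

lemma far_points_Linf_cases:
  assumes "w \<in> far_points (min \<epsilon> \<delta>) (Linf x y)"
  obtains "linf_fst w \<in> far_points \<epsilon> x" "linf_snd w \<in> cball 0 1"
    | "linf_fst w \<in> cball 0 1" "linf_snd w \<in> far_points \<delta> y"
  using assms
  by (auto simp: far_points_def norm_linf_sum_def minus_linf_sum_def max_def min_def split: if_splits)

theorem theorem3p2:
  fixes x :: "'a::banach" and y :: "'b::banach"
  assumes "x \<in> cball 0 1" and "y \<in> cball 0 1"
    and "Daugavet_point (Linf x y)"
  shows "Daugavet_point x \<or> Daugavet_point y"
proof (rule ccontr)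
  assume "\<not> ?thesis"
  then have nx: "\<not> Daugavet_point x" and ny: "\<not> Daugavet_point y"
    by auto
  have norm_x: "norm x \<le> 1" and norm_y: "norm y \<le> 1"
    using assms(1,2) by auto
  obtain \<epsilon> f u where f: "\<epsilon> > 0" "convex_on UNIV f" "continuous_on UNIV f"
    "\<forall>w\<in>cball 0 1. f w \<le> 1" "\<forall>w\<in>far_points \<epsilon> x. f w = 0"
    "u \<in> cball 0 1" "f u > 1 / 2"
    by (rule not_Daugavet_pointE[OF norm_x nx])
  obtain \<delta> g v where g: "\<delta> > 0" "convex_on UNIV g" "continuous_on UNIV g"
    "\<forall>w\<in>cball 0 1. g w \<le> 1" "\<forall>w\<in>far_points \<delta> y. g w = 0"
    "v \<in> cball 0 1" "g v > 1 / 2"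
    by (rule not_Daugavet_pointE[OF norm_y ny])
  define F where "F w = f (linf_fst w) + g (linf_snd w)" for w
  have "convex_on UNIV F"
    unfolding F_def
    using convex_on_compose_linear[OF bounded_linear.linear[OF bounded_linear_linf_fst] f(2)]
      convex_on_compose_linear[OF bounded_linear.linear[OF bounded_linear_linf_snd] g(2)]
    by (rule convex_on_add)
  have conv: "convex {w. F w \<le> 1}"
  proof (rule convexI)
    fix p q and a b :: real
    assume "p \<in> {w. F w \<le> 1}" "q \<in> {w. F w \<le> 1}" and ab: "0 \<le> a" "0 \<le> b" "a + b = 1"
    then have "a * F p + b * F q \<le> 1"
      by (intro convex_bound_le) auto
    moreover have "F (a *\<^sub>R p + b *\<^sub>R q) \<le> a * F p + b * F q"
      using \<open>convex_on UNIV F\<close> ab by (simp add: convex_on_def)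
    ultimately show "a *\<^sub>R p + b *\<^sub>R q \<in> {w. F w \<le> 1}"
      by simp
  qed
  have "continuous_on UNIV F"
    unfolding F_def
    using continuous_on_compose2[OF f(3) linear_continuous_on[OF bounded_linear_linf_fst]]
      continuous_on_compose2[OF g(3) linear_continuous_on[OF bounded_linear_linf_snd]]
    by (intro continuous_on_add) auto
  then have closed: "closed {w. F w \<le> 1}"
    by (intro closed_Collect_le continuous_on_const)
  \<comment> \<open>The far coordinate contributes 0 to \<open>F\<close>, the other one at most
    1.\<close>
  have "far_points (min \<epsilon> \<delta>) (Linf x y) \<subseteq> {w. F w \<le> 1}"
  proof
    fix w
    assume "w \<in> far_points (min \<epsilon> \<delta>) (Linf x y)"
    then show "w \<in> {w. F w \<le> 1}"
    proof (cases rule: far_points_Linf_cases)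
      case 1
      then have "f (linf_fst w) = 0" "g (linf_snd w) \<le> 1"
        using f(5) g(4) by blast+
      then show ?thesis
        by (simp add: F_def)
    next
      case 2
      then have "f (linf_fst w) \<le> 1" "g (linf_snd w) = 0"
        using f(4) g(5) by blast+
      then show ?thesis
        by (simp add: F_def)
    qed
  qed
  then have "closure (convex hull far_points (min \<epsilon> \<delta>) (Linf x y)) \<subseteq> {w. F w \<le> 1}"
    using conv closed by (intro closure_minimal hull_minimal)
  \<comment> \<open>In the max norm, a pair of points of the unit balls lies in the unit ball; here
    \<open>F\<close> exceeds 1 / 2 + 1 / 2.\<close>
  moreover have "Linf u v \<in> closure (convex hull far_points (min \<epsilon> \<delta>) (Linf x y))"
    using assms(3) f(1,6) g(1,6) by (auto simp: Daugavet_point_def norm_linf_sum_def subset_iff)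
  ultimately show False
    using f(7) g(7) by (auto simp: F_def)
qed

end
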